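(* Let $\mathbb{K}=\mathbb{R}$ or $\mathbb{C}$ and let $f,g:(\mathbb{K}^n,0)\to(\mathbb{K}^p,0)$ be two smooth map germs. If $f$ and $g$ are bi-Lipschitz equivalent, then the rank of $f$ at $0$ is equal to the rank of $g$ at $0$.
   Context: "Smooth" means $C^\infty$ if $\mathbb{K}=\mathbb{R}$ and holomorphic if $\mathbb{K}=\mathbb{C}$. The rank of a map germ at $0$ is the rank of its derivative at $0$. Two map germs $f,g:(\mathbb{K}^n,0)\to(\mathbb{K}^p,0)$ are bi-Lipschitz (right) equivalent if there is a germ of homeomorphism $\varphi:(\mathbb{K}^n,0)\to(\mathbb{K}^n,0)$ with $f\circ\varphi=g$ and a constant $L>0$ such that $\frac1L\|x-y\|\le\|\varphi(x)-\varphi(y)\|\le L\|x-y\|$ for all $x,y$ in a neighbourhood of $0$, where $\|\cdot\|$ is the Euclidean norm. *)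

theory Defs
  imports "HOL-Analysis.Analysis"
begin

text \<open>
  A map germ \<open>(K^n, 0) \<rightarrow> (K^p, 0)\<close> is given by a representative \<open>f :: 'a^'n \<Rightarrow> 'a^'p\<close>, a total
  function whose values away from \<open>0\<close> are irrelevant: every notion below depends only on the
  restriction of \<open>f\<close> to arbitrarily small neighbourhoods of \<open>0\<close>.
  The norm on \<open>'a^'n\<close> is the Euclidean (for complex scalars: Hermitian) norm.
\<close>

text \<open>\<open>C^k\<close> on an open set: all iterated directional derivatives up to order \<open>k\<close> exist, are
  differentiable below order \<open>k\<close>, and are continuous at order \<open>k\<close>.\<close>

primrec Ck_on :: "nat \<Rightarrow> (real^'n) set \<Rightarrow> (real^'n \<Rightarrow> real^'p) \<Rightarrow> bool" where
  "Ck_on 0 S f \<longleftrightarrow> continuous_on S f"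
| "Ck_on (Suc k) S f \<longleftrightarrow>
     (\<forall>x\<in>S. f differentiable (at x)) \<and>
     (\<forall>v. Ck_on k S (\<lambda>x. frechet_derivative f (at x) v))"

definition smooth_real_germ :: "(real^'n \<Rightarrow> real^'p) \<Rightarrow> bool" where
  "smooth_real_germ f \<longleftrightarrow>
     f 0 = 0 \<and> (\<exists>S. open S \<and> 0 \<in> S \<and> (\<forall>k. Ck_on k S f))"

text \<open>The library's \<open>holomorphic_on\<close> covers one variable only; in several variables a map is
  holomorphic on an open set if at each point it has a complex-linear (Frechet) derivative.\<close>

definition holomorphic_map_on :: "(complex^'n \<Rightarrow> complex^'p) \<Rightarrow> (complex^'n) set \<Rightarrow> bool" where
  "holomorphic_map_on f S \<longleftrightarrow>
     (\<forall>x\<in>S. \<exists>D. (f has_derivative D) (at x) \<and> Vector_Spaces.linear (*s) (*s) D)"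

definition holomorphic_germ :: "(complex^'n \<Rightarrow> complex^'p) \<Rightarrow> bool" where
  "holomorphic_germ f \<longleftrightarrow>
     f 0 = 0 \<and> (\<exists>S. open S \<and> 0 \<in> S \<and> holomorphic_map_on f S)"

text \<open>\<open>vec.dim\<close> is the dimension over the scalar field \<open>'a\<close> itself, so for complex scalars this is
  the complex rank.\<close>

definition rank_at_0 :: "('a::real_normed_field^'n \<Rightarrow> 'a^'p) \<Rightarrow> nat" where
  "rank_at_0 f = vec.dim (range (frechet_derivative f (at 0)))"

definition homeomorphism_germ :: "('a::real_normed_field^'n \<Rightarrow> 'a^'n) \<Rightarrow> bool" where
  "homeomorphism_germ \<phi> \<longleftrightarrow>
     \<phi> 0 = 0 \<and>
     (\<exists>U V \<psi>. open U \<and> 0 \<in> U \<and> open V \<and> 0 \<in> V \<and> homeomorphism U V \<phi> \<psi>)"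

definition bilipschitz_germ :: "('a::real_normed_field^'n \<Rightarrow> 'a^'n) \<Rightarrow> bool" where
  "bilipschitz_germ \<phi> \<longleftrightarrow>
     (\<exists>L>0. \<exists>W. open W \<and> 0 \<in> W \<and>
        (\<forall>x\<in>W. \<forall>y\<in>W. (1 / L) * norm (x - y) \<le> norm (\<phi> x - \<phi> y) \<and>
                      norm (\<phi> x - \<phi> y) \<le> L * norm (x - y)))"

definition bilipschitz_equivalent ::
    "('a::real_normed_field^'n \<Rightarrow> 'a^'p) \<Rightarrow> ('a^'n \<Rightarrow> 'a^'p) \<Rightarrow> bool" where
  "bilipschitz_equivalent f g \<longleftrightarrow>
     (\<exists>\<phi>. homeomorphism_germ \<phi> \<and> bilipschitz_germ \<phi> \<and>
          eventually (\<lambda>x. f (\<phi> x) = g x) (nhds 0))"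

end

theory Submission
  imports Defs
begin

text \<open>Write \<open>A\<close>, \<open>B\<close> for the derivatives of \<open>f\<close>, \<open>g\<close> at \<open>0\<close>. From \<open>f \<circ> \<phi> = g\<close> and \<open>\<phi>(x) = O(x)\<close>
  one gets \<open>B v = lim A (\<phi>(t v) / t)\<close> as \<open>t \<rightarrow> 0\<close>, so \<open>B v\<close> lies in the closure of the image of \<open>A\<close>,
  which is closed because it is a finite-dimensional subspace. The inverse of \<open>\<phi>\<close> gives the opposite
  inclusion, so the two derivatives even have the same image.\<close>

lemma range_derivative_subset:
  fixes f :: "'a::real_normed_vector \<Rightarrow> 'c::euclidean_space"
    and g :: "'b::real_normed_vector \<Rightarrow> 'c"
  assumes f: "(f has_derivative A) (at 0)" "f 0 = 0"
    and g: "(g has_derivative B) (at 0)" "g 0 = 0"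
    and lip: "\<forall>\<^sub>F x in nhds 0. norm (\<phi> x) \<le> L * norm x"
    and eq: "\<forall>\<^sub>F x in nhds 0. f (\<phi> x) = g x"
  shows "range B \<subseteq> range A"
proof
  fix w assume "w \<in> range B"
  then obtain v where w: "w = B v" by blast
  have linA: "bounded_linear A" and linB: "bounded_linear B"
    using f g by (auto intro: has_derivative_bounded_linear)
  \<comment> \<open>The limit is made quantitative: for a small t > 0 the vector
    \<open>A (\<phi> (t v) / t)\<close> is the required point of \<open>range A\<close>.\<close>
  have near: "\<exists>y\<in>range A. dist y w < e" if "e > 0" for e
  proof -
    \<comment> \<open>Taking the maximum with 1 gives a positive bound, so that
      \<open>d1 / L'\<close> is a positive radius. The constant \<open>c\<close> is chosen so that
      the final error bound is exactly \<open>e\<close>; the summand 1 in \<open>norm v + 1\<close>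
      covers v = 0 and makes the estimate strict.\<close>
    define L' where "L' = max L 1"
    define c where "c = e / ((1 + L') * (norm v + 1))"
    have L': "L' > 0" "L \<le> L'" by (auto simp: L'_def)
    have pos: "(1 + L') * (norm v + 1) > 0" using L' by (simp add: add_nonneg_pos)
    have c: "c > 0" using \<open>e > 0\<close> pos by (simp add: c_def)
    obtain d1 where d1: "d1 > 0" "\<And>y. norm y < d1 \<Longrightarrow> norm (f y - A y) \<le> c * norm y"
      using f c unfolding has_derivative_at_alt by force
    obtain d2 where d2: "d2 > 0" "\<And>y. norm y < d2 \<Longrightarrow> norm (g y - B y) \<le> c * norm y"
      using g c unfolding has_derivative_at_alt by force
    obtain d3 where d3: "d3 > 0"
        "\<And>x. norm x < d3 \<Longrightarrow> norm (\<phi> x) \<le> L * norm x \<and> f (\<phi> x) = g x"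
      using eventually_conj[OF lip eq] unfolding eventually_nhds_metric by auto
    \<comment> \<open>The radius \<open>d1 / L'\<close> puts \<open>\<phi> x\<close> within
      \<open>d1\<close> of 0 whenever x is within \<open>d\<close>; \<open>t\<close> then puts
      \<open>t v\<close> within \<open>d\<close>.\<close>
    define d where "d = min (d1 / L') (min d2 d3)"
    define t where "t = d / (2 * (norm v + 1))"
    have d: "d > 0" using d1 d2 d3 L' by (simp add: d_def)
    have t: "t > 0" using d by (simp add: t_def add_nonneg_pos)
    define x where "x = t *\<^sub>R v"
    have nx: "norm x = t * norm v" using t by (simp add: x_def)
    have "norm v < 2 * (norm v + 1)"
      using norm_ge_zero[of v] unfolding distrib_left by linarith
    then have "norm x < t * (2 * (norm v + 1))"
      unfolding nx using t by (rule mult_strict_left_mono)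
    also have "\<dots> = d" by (simp add: t_def) (smt (verit) norm_ge_zero)
    finally have xd: "norm x < d" .
    have \<phi>x: "norm (\<phi> x) \<le> L' * norm x" and fg: "f (\<phi> x) = g x"
      using d3(2)[of x] xd mult_right_mono[OF L'(2) norm_ge_zero[of x]] by (auto simp: d_def)
    have "L' * norm x < d1" using xd L' by (simp add: d_def field_simps)
    with \<phi>x have "norm (\<phi> x) < d1" by linarith
    then have "norm (f (\<phi> x) - A (\<phi> x)) \<le> c * norm (\<phi> x)" by (rule d1)
    also have "\<dots> \<le> c * (L' * norm x)" using \<phi>x c by (simp add: mult_left_mono)
    finally have 1: "norm (g x - A (\<phi> x)) \<le> c * (L' * norm x)" by (simp add: fg)
    have 2: "norm (g x - B x) \<le> c * norm x" using d2(2)[of x] xd by (simp add: d_def)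
    \<comment> \<open>Both \<open>A (\<phi> x)\<close> and \<open>B x\<close> approximate the same
      vector g x = f(\<phi>(x)), with errors linear in \<open>t\<close>.\<close>
    have "norm (A (\<phi> x) - B x) \<le> norm (g x - B x) + norm (g x - A (\<phi> x))"
      using norm_triangle_ineq4[of "g x - B x" "g x - A (\<phi> x)"] by simp
    also have "\<dots> \<le> t * (c * (1 + L') * norm v)"
      using 1 2 by (simp add: nx algebra_simps)
    finally have 3: "norm (A (\<phi> x) - B x) \<le> t * (c * (1 + L') * norm v)" .
    \<comment> \<open>Only \<open>A\<close> and \<open>B\<close> are homogeneous, so the factor 1/t
      is applied to the value of \<open>\<phi>\<close>, not to its argument.\<close>
    have "A (\<phi> x) - B x = t *\<^sub>R (A (\<phi> x /\<^sub>R t) - B v)"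
      using t by (simp add: x_def linear_simps[OF linA] linear_simps[OF linB] scaleR_diff_right)
    with 3 t have "norm (A (\<phi> x /\<^sub>R t) - B v) \<le> c * (1 + L') * norm v"
      by simp
    also have "\<dots> < c * (1 + L') * (norm v + 1)"
      using c L' by (intro mult_strict_left_mono) auto
    also have "\<dots> = e" using pos by (auto simp: c_def)
    finally show ?thesis by (auto simp: w dist_norm)
  qed
  have "closed (range A)"
    by (intro closed_subspace linear_subspace_image bounded_linear.linear[OF linA]) auto
  with near show "w \<in> range A"
    by (metis closure_approachable closure_closed)
qed

text \<open>Treats real and complex scalars at once. The two images coincide as sets, so their
  dimensions over \<open>'a\<close> agree even though the derivatives are taken only as real-linear
  maps.\<close>

lemma bilipschitz_equivalent_rank_at_0_eq:
  fixes f g :: "'a::{real_normed_field,euclidean_space}^'n \<Rightarrow> 'a^'p"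
  assumes f: "f differentiable (at 0)" "f 0 = 0"
    and g: "g differentiable (at 0)" "g 0 = 0"
    and equiv: "bilipschitz_equivalent f g"
  shows "rank_at_0 f = rank_at_0 g"
proof -
  have f': "(f has_derivative frechet_derivative f (at 0)) (at 0)"
    and g': "(g has_derivative frechet_derivative g (at 0)) (at 0)"
    using f g by (simp_all add: frechet_derivative_works)
  obtain \<phi> \<psi> U V L W where \<phi>0: "\<phi> 0 = 0" and U: "open U" "0 \<in> U" and V: "open V" "0 \<in> V"
    and hom: "homeomorphism U V \<phi> \<psi>" and L: "L > 0" and W: "open W" "0 \<in> W"
    and lip: "\<And>x y. x \<in> W \<Longrightarrow> y \<in> W \<Longrightarrow> (1 / L) * norm (x - y) \<le> norm (\<phi> x - \<phi> y) \<and>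
                      norm (\<phi> x - \<phi> y) \<le> L * norm (x - y)"
    and eq: "\<forall>\<^sub>F x in nhds 0. f (\<phi> x) = g x"
    using equiv unfolding bilipschitz_equivalent_def homeomorphism_germ_def bilipschitz_germ_def
    by blast
  have \<psi>0: "\<psi> 0 = 0" using hom U(2) \<phi>0 by (metis homeomorphism_apply1)
  have W_ev: "\<forall>\<^sub>F x in nhds 0. x \<in> W" using W by (rule eventually_nhds_in_open)
  have "isCont \<psi> 0"
    using hom V by (auto simp: homeomorphism_def continuous_on_eq_continuous_at)
  \<comment> \<open>This transports every property valid near 0 along \<open>\<psi>\<close>.\<close>
  then have \<psi>_lim: "filterlim \<psi> (nhds 0) (nhds 0)"
    using tendsto_at_iff_tendsto_nhds[of \<psi> 0] by (simp add: isCont_def \<psi>0)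
  have inv: "\<forall>\<^sub>F y in nhds 0. \<phi> (\<psi> y) = y"
    using eventually_nhds_in_open[OF V] by eventually_elim (rule homeomorphism_apply2[OF hom])
  have "\<forall>\<^sub>F x in nhds 0. norm (\<phi> x) \<le> L * norm x"
    using W_ev by eventually_elim (use lip[of _ 0] W \<phi>0 in auto)
  then have sub: "range (frechet_derivative g (at 0)) \<subseteq> range (frechet_derivative f (at 0))"
    using eq by (rule range_derivative_subset[OF f' f(2) g' g(2)])
  \<comment> \<open>The lower Lipschitz bound of \<open>\<phi>\<close>, at the points
    \<open>\<psi> y\<close> and 0, is an upper bound for \<open>\<psi>\<close> with the same
    constant.\<close>
  have "\<forall>\<^sub>F y in nhds 0. norm (\<psi> y) \<le> L * norm y"
    using eventually_compose_filterlim[OF W_ev \<psi>_lim] inv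
    by eventually_elim (use lip[of _ 0] W \<phi>0 L in \<open>force simp: field_simps\<close>)
  moreover have "\<forall>\<^sub>F y in nhds 0. g (\<psi> y) = f y"
    using eventually_compose_filterlim[OF eq \<psi>_lim] inv by eventually_elim simp
  ultimately have "range (frechet_derivative f (at 0)) \<subseteq> range (frechet_derivative g (at 0))"
    by (rule range_derivative_subset[OF g' g(2) f' f(2)])
  with sub show ?thesis by (simp add: rank_at_0_def)
qed

lemma smooth_real_germ_differentiable:
  assumes "smooth_real_germ f"
  shows "f differentiable (at 0)"
proof -
  \<comment> \<open>Order 1 is the first at which \<open>Ck_on\<close> asserts differentiability;
    order 0 is continuity alone.\<close>
  obtain S where "0 \<in> S" "Ck_on (Suc 0) S f"
    using assms unfolding smooth_real_germ_def by blast
  then show ?thesis by simp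
qed

lemma holomorphic_germ_differentiable:
  assumes "holomorphic_germ f"
  shows "f differentiable (at 0)"
  using assms
  unfolding holomorphic_germ_def holomorphic_map_on_def differentiable_def by blast

theorem theorem4p1:
  shows "(\<forall>f g :: real^'n \<Rightarrow> real^'p.
            smooth_real_germ f \<longrightarrow> smooth_real_germ g \<longrightarrow> bilipschitz_equivalent f g \<longrightarrow>
            rank_at_0 f = rank_at_0 g) \<and>
         (\<forall>f g :: complex^'n \<Rightarrow> complex^'p.
            holomorphic_germ f \<longrightarrow> holomorphic_germ g \<longrightarrow> bilipschitz_equivalent f g \<longrightarrow>
            rank_at_0 f = rank_at_0 g)"
  by (intro conjI allI impI bilipschitz_equivalent_rank_at_0_eq)
    (simp_all add: smooth_real_germ_differentiable holomorphic_germ_differentiable,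
     simp_all add: smooth_real_germ_def holomorphic_germ_def)

end
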